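(* Let $A$ be a polynomial (with complex coefficients) of degree at least two such that $A:\mathcal O\to\mathcal O$ is a minimal holomorphic map between orbifolds for some orbifold $\mathcal O$ on $\mathbb{CP}^1$ distinct from the non-ramified sphere. Then either $A$ is conjugate to $z^rR(z)^n$, where $R\in\mathbb C[z]$, $n\geq2$, $r\ge 1$ and $\gcd(r,n)=1$, or $A$ is conjugate to $\pm T_m$, where $m=\deg A$ and $\gcd(m,n)=1$ for some integer $n\geq1$.
   Context: $T_m$ is the Chebyshev polynomial of degree $m$, $T_m(\cos t)=\cos(mt)$. Conjugate means conjugate by a Möbius transformation. An orbifold $\mathcal O$ on $\mathbb{CP}^1$ is a ramification function $\nu:\mathbb{CP}^1\to\mathbb N=\{1,2,\dots\}$ with $\nu(z)=1$ except at a finite set of points; it is not allowed that there is exactly one point with $\nu(z)\neq1$, nor that there are exactly two such points with different values of $\nu$. The non-ramified sphere is the orbifold with $\nu\equiv1$. A rational function $A$ is a minimal holomorphic map $A:\mathcal O\to\mathcal O$ if $\nu(A(z))=\nu(z)\gcd(\deg_zA,\nu(A(z)))$ for all $z\in\mathbb{CP}^1$, where $\deg_zA$ is the local degree of $A$ at $z$. *)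

theory Defs
  imports "HOL-Complex_Analysis.Complex_Analysis"
    "HOL-Computational_Algebra.Computational_Algebra"
begin

text \<open>
  The Riemann sphere is the one-point compactification of the complex plane, with the
  point at infinity represented by \<open>None\<close> (as in \<open>Alexandroff_compactification\<close>).
\<close>

type_synonym rsphere = "complex option"

text \<open>
  The self-map of the sphere induced by \<open>p / q\<close>; meaningful if \<open>q \<noteq> 0\<close> and \<open>p\<close>, \<open>q\<close> are coprime.
  If \<open>degree p < degree q\<close>, the value at infinity is \<open>0\<close> because \<open>coeff p (degree q) = 0\<close>.
\<close>

fun rat_map :: "complex poly \<Rightarrow> complex poly \<Rightarrow> rsphere \<Rightarrow> rsphere" where
  "rat_map p q (Some z) = (if poly q z = 0 then None else Some (poly p z / poly q z))"
| "rat_map p q None =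
     (if degree p > degree q then None else Some (coeff p (degree q) / lead_coeff q))"

abbreviation poly_map :: "complex poly \<Rightarrow> rsphere \<Rightarrow> rsphere" where
  "poly_map p \<equiv> rat_map p 1"

definition rational_function :: "(rsphere \<Rightarrow> rsphere) \<Rightarrow> bool" where
  "rational_function f \<longleftrightarrow> (\<exists>p q. q \<noteq> 0 \<and> coprime p q \<and> f = rat_map p q)"

definition mobius :: "(rsphere \<Rightarrow> rsphere) \<Rightarrow> bool" where
  "mobius \<mu> \<longleftrightarrow> (\<exists>a b c d. a * d - b * c \<noteq> 0 \<and> \<mu> = rat_map [:b, a:] [:d, c:])"

definition mobius_conjugate :: "(rsphere \<Rightarrow> rsphere) \<Rightarrow> (rsphere \<Rightarrow> rsphere) \<Rightarrow> bool" where
  "mobius_conjugate f g \<longleftrightarrow> (\<exists>\<mu>. mobius \<mu> \<and> g = \<mu> \<circ> f \<circ> inv \<mu>)"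

text \<open>
  Local parametrization of the sphere centred at a given point (\<open>x \<mapsto> a + x\<close> at a finite point
  \<open>a\<close>, \<open>x \<mapsto> 1 / x\<close> at infinity), and the inverse local coordinate. The coordinate is only used
  near its centre, so its values far away (at infinity for a finite centre, at \<open>0\<close> for the centre
  at infinity) are irrelevant.
\<close>

fun local_param :: "rsphere \<Rightarrow> complex \<Rightarrow> rsphere" where
  "local_param (Some a) x = Some (a + x)"
| "local_param None x = (if x = 0 then None else Some (1 / x))"

fun local_coord :: "rsphere \<Rightarrow> rsphere \<Rightarrow> complex" where
  "local_coord (Some b) (Some w) = w - b"
| "local_coord (Some b) None = 0"
| "local_coord None (Some w) = 1 / w"
| "local_coord None None = 0"

text \<open>
  The local degree at \<open>z\<close> of a nonconstant holomorphic self-map of the sphere: the order of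
  vanishing at the origin of the map written in local coordinates centred at \<open>z\<close> and at its image.
\<close>

definition local_degree :: "(rsphere \<Rightarrow> rsphere) \<Rightarrow> rsphere \<Rightarrow> nat" where
  "local_degree f z = nat (zorder (\<lambda>x. local_coord (f z) (f (local_param z x))) 0)"

definition orbifold :: "(rsphere \<Rightarrow> nat) \<Rightarrow> bool" where
  "orbifold \<nu> \<longleftrightarrow>
     (\<forall>z. \<nu> z \<ge> 1) \<and>
     finite {z. \<nu> z \<noteq> 1} \<and>
     \<not> (\<exists>a. {z. \<nu> z \<noteq> 1} = {a}) \<and>
     \<not> (\<exists>a b. a \<noteq> b \<and> {z. \<nu> z \<noteq> 1} = {a, b} \<and> \<nu> a \<noteq> \<nu> b)"

text \<open>Constant maps are excluded because they have no local degree.\<close>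

definition minimal_holomorphic_map :: "(rsphere \<Rightarrow> rsphere) \<Rightarrow> (rsphere \<Rightarrow> nat) \<Rightarrow> bool" where
  "minimal_holomorphic_map f \<nu> \<longleftrightarrow>
     rational_function f \<and> \<not> f constant_on UNIV \<and>
     (\<forall>z. \<nu> (f z) = \<nu> z * gcd (local_degree f z) (\<nu> (f z)))"

definition chebyshev :: "nat \<Rightarrow> complex poly" where
  "chebyshev m = (THE p. \<forall>t. poly p (cos t) = cos (of_nat m * t))"

text \<open>The defining property determines a unique polynomial.\<close>

lemma chebyshev_unique:
  fixes p q :: "complex poly"
  assumes "\<And>t. poly p (cos t) = poly q (cos t)"
  shows "p = q"
proof -
  have "poly p z = poly q z" for z
    using assms[of "Arccos z"] by simp
  then show ?thesis
    by (simp add: poly_eq_poly_eq_iff[symmetric] fun_eq_iff)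
qed

lemma chebyshev_exists:
  "\<exists>p :: complex poly. \<forall>t. poly p (cos t) = cos (of_nat m * t)"
proof (induction m rule: less_induct)
  case (less m)
  show ?case
  proof (cases "m \<le> 1")
    case True
    then consider "m = 0" | "m = 1" by linarith
    then show ?thesis
    proof cases
      case 1
      then show ?thesis by (intro exI[of _ 1]) simp
    next
      case 2
      then show ?thesis by (intro exI[of _ "[:0, 1:]"]) simp
    qed
  next
    case False
    then obtain k where m: "m = Suc (Suc k)"
      by (metis One_nat_def Suc_le_mono le0 not0_implies_Suc)
    obtain p :: "complex poly" where p: "\<And>t. poly p (cos t) = cos (of_nat (Suc k) * t)"
      using less.IH[of "Suc k"] m by blast
    obtain q :: "complex poly" where q: "\<And>t. poly q (cos t) = cos (of_nat k * t)"
      using less.IH[of k] m by auto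
    have "poly ([:0, 2:] * p - q) (cos t) = cos (of_nat m * t)" for t
    proof -
      have m_eq: "of_nat m * t = of_nat (Suc k) * t + t"
        and k_eq: "of_nat k * t = of_nat (Suc k) * t - t"
        by (simp_all add: m algebra_simps)
      have "poly ([:0, 2:] * p - q) (cos t) =
          2 * cos t * cos (of_nat (Suc k) * t) - cos (of_nat (Suc k) * t - t)"
        by (simp only: poly_diff poly_mult p q k_eq) simp
      also have "\<dots> = cos (of_nat m * t)"
        unfolding m_eq cos_add cos_diff by simp
      finally show ?thesis .
    qed
    then show ?thesis by blast
  qed
qed

lemma poly_chebyshev_cos: "poly (chebyshev m) (cos t) = cos (of_nat m * t)"
proof -
  have "\<exists>!p :: complex poly. \<forall>t. poly p (cos t) = cos (of_nat m * t)"
    using chebyshev_exists[of m] chebyshev_unique by metis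
  from theI'[OF this] show ?thesis
    unfolding chebyshev_def by blast
qed

end

theory Submission imports Defs begin

text \<open>
  Let \<open>F\<close> be the set of finite points with \<open>\<nu> \<ge> 2\<close>, let \<open>k = card F\<close> and \<open>d = deg A\<close>, and
  let \<open>e z\<close> be the multiplicity of \<open>A\<close> at \<open>z\<close>. Some point is ramified, and infinity is not the only
  one by the definition of an orbifold, so \<open>k \<ge> 1\<close>. If \<open>A z \<in> F\<close> but \<open>z \<notin> F\<close>,
  minimality reads \<open>\<nu> (A z) = gcd (e z) (\<nu> (A z))\<close>, so \<open>\<nu> (A z)\<close> divides \<open>e z\<close>; in particular \<open>z\<close> is a critical point. Hence the points over \<open>F\<close> are critical apart
  from at most \<open>k\<close> of them, and comparing multiplicities of roots gives the divisibility
  \<open>(\<Prod>b\<in>F. A - b) dvd (\<Prod>b\<in>F. x - b) * A'\<^sup>2\<close>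
  (\<open>fibre_product_dvd\<close>). Degrees yield \<open>k d \<le> k + 2 (d - 1)\<close>, that is \<open>k \<le> 2\<close>.

  If \<open>F = {a}\<close>, then \<open>a\<close> is a fixed point, because \<open>A\<close> maps ramified points to ramified points. For
  \<open>n = \<nu> a\<close>, the multiplicity of \<open>A\<close> at \<open>a\<close> is coprime to \<open>n\<close>, and all its multiplicities at the
  other preimages of \<open>a\<close> are divisible by \<open>n\<close>; so \<open>A - a = (x - a)^r * R^n\<close>
  (\<open>conjugate_to_power_form\<close>).

  If \<open>F = {a, b}\<close>, both sides of the divisibility have degree \<open>2 d\<close>, so they agree up to a constant
  factor (\<open>conjugate_to_chebyshev\<close>). After moving \<open>a, b\<close> to \<open>1, -1\<close> this is the differential equation
  \<open>(z\<^sup>2 - 1) B'\<^sup>2 = d\<^sup>2 (B\<^sup>2 - 1)\<close>. Differentiating it once more and substituting \<open>z = cos t\<close> turns it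
  into the equation \<open>f'' = - d\<^sup>2 f\<close> of the harmonic oscillator for \<open>f t = B (cos t)\<close>, whence
  \<open>f t = B 1 * cos (d t)\<close> with \<open>B 1 = \<plusminus>1\<close> (\<open>chebyshev_ode\<close>). The coprimality demanded in this
  case is witnessed by \<open>n = 1\<close>.
\<close>

section \<open>Complex polynomials and multiplicities of roots\<close>

lemma minus_const_poly:
  fixes p :: "'a::comm_ring_1 poly"
  assumes "degree p \<ge> 1"
  shows degree_minus_const: "degree (p - [:c:]) = degree p"
    and lead_coeff_minus_const: "lead_coeff (p - [:c:]) = lead_coeff p"
    and minus_const_nonzero: "p - [:c:] \<noteq> 0"
proof -
  show deg: "degree (p - [:c:]) = degree p"
    unfolding diff_conv_add_uminus using assms by (intro degree_add_eq_left) simp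
  show "lead_coeff (p - [:c:]) = lead_coeff p"
    unfolding deg using assms by (cases "degree p") auto
  show "p - [:c:] \<noteq> 0"
    using deg assms by auto
qed

lemma complex_poly_dvdI_order:
  fixes p q :: "complex poly"
  assumes "p \<noteq> 0" "q \<noteq> 0" "\<And>z. order z p \<le> order z q"
  shows "p dvd q"
proof -
  have "proots p \<subseteq># proots q"
    using assms by (simp add: subseteq_mset_def)
  then have "(\<Prod>x\<in>#proots p. [:-x, 1:]) dvd (\<Prod>x\<in>#proots q. [:-x, 1:])"
    by (intro prod_mset_subset_imp_dvd image_mset_subseteq_mono)
  then have "smult (lead_coeff p) (\<Prod>x\<in>#proots p. [:-x, 1:]) dvd
      smult (lead_coeff q) (\<Prod>x\<in>#proots q. [:-x, 1:])"
    using assms by (simp add: smult_dvd_iff dvd_smult)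
  then show ?thesis
    by (simp only: complex_poly_decompose_multiset)
qed

lemma complex_poly_nth_rootE:
  fixes p :: "complex poly"
  assumes "p \<noteq> 0" "n \<ge> 1" "\<And>z. n dvd order z p"
  obtains q where "p = q ^ n"
proof
  let ?c = "exp (Ln (lead_coeff p) / of_nat n)"
  let ?q = "\<Prod>z | poly p z = 0. [:-z, 1:] ^ (order z p div n)"
  have c: "?c ^ n = lead_coeff p"
    using assms by (simp add: exp_of_nat_mult[symmetric])
  have "?q ^ n = (\<Prod>z | poly p z = 0. [:-z, 1:] ^ order z p)"
    using assms(3) by (simp add: prod_power_distrib power_mult[symmetric])
  then have "(smult ?c ?q) ^ n = smult (lead_coeff p) (\<Prod>z | poly p z = 0. [:-z, 1:] ^ order z p)"
    by (simp only: smult_power c)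
  then show "p = (smult ?c ?q) ^ n"
    by (simp add: complex_poly_decompose)
qed

text \<open>
  At a root \<open>z\<close> of multiplicity \<open>e\<close> of the left-hand side, \<open>A'\<close> vanishes to order \<open>e - 1\<close>. So
  \<open>A'\<^sup>2\<close> suffices where \<open>e \<ge> 2\<close>, and one further factor \<open>x - z\<close> is enough where \<open>z \<in> F\<close>.
\<close>

lemma fibre_product_dvd:
  fixes A :: "complex poly"
  assumes "finite F" "degree A \<ge> 1"
    and crit: "\<And>z. poly A z \<in> F \<Longrightarrow> z \<notin> F \<Longrightarrow> order z (A - [:poly A z:]) \<ge> 2"
  shows "(\<Prod>b\<in>F. A - [:b:]) dvd (\<Prod>b\<in>F. [:-b, 1:]) * pderiv A ^ 2"
proof -
  define P where "P = (\<Prod>b\<in>F. A - [:b:])"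
  define G where "G = (\<Prod>b\<in>F. [:-b, 1:] :: complex poly)"
  have nz: "A - [:b:] \<noteq> 0" for b
    using assms(2) by (rule minus_const_nonzero)
  have A': "pderiv A \<noteq> 0"
    using assms(2) by (simp add: pderiv_eq_0_iff)
  have G: "G \<noteq> 0"
    unfolding G_def using assms(1) by simp
  have P: "P \<noteq> 0"
    unfolding P_def using assms(1) nz by simp
  have "order z P \<le> order z (G * pderiv A ^ 2)" for z
  proof (cases "poly A z \<in> F")
    case False
    then have "poly P z \<noteq> 0"
      unfolding P_def using assms(1) by (auto simp: poly_prod)
    then show ?thesis
      by (simp add: order_0I)
  next
    case True
    let ?Q = "\<Prod>b\<in>F - {poly A z}. A - [:b:]" and ?e = "order z (A - [:poly A z:])"
    have split: "P = (A - [:poly A z:]) * ?Q"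
      unfolding P_def using assms(1) True by (simp add: prod.remove)
    have "poly ?Q z \<noteq> 0"
      using assms(1) by (auto simp: poly_prod)
    then have "order z P = ?e"
      using P unfolding split by (simp add: order_mult order_0I)
    moreover have "?e = Suc (order z (pderiv A))"
      using order_pderiv[OF nz, of "poly A z" z] by (simp add: pderiv_diff)
    moreover have "order z (G * pderiv A ^ 2) = order z G + 2 * order z (pderiv A)"
      using G A' by (simp add: order_mult power2_eq_square)
    moreover have "order z G \<ge> 1 \<or> ?e \<ge> 2"
    proof (cases "z \<in> F")
      case True
      then have "poly G z = 0"
        unfolding G_def using assms(1) by (auto simp: poly_prod)
      then show ?thesis
        using G order_root[of G z] by auto
    qed (use crit True in auto)
    ultimately show ?thesis
      by linarith
  qed
  then have "P dvd G * pderiv A ^ 2"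
    using P G A' by (intro complex_poly_dvdI_order) auto
  then show ?thesis
    by (simp only: P_def G_def)
qed

section \<open>Polynomials as maps of the sphere\<close>

lemma local_degree_poly_map:
  assumes "degree A \<ge> 1"
  shows "local_degree (poly_map A) (Some z) = order z (A - [:poly A z:])"
proof -
  let ?p = "A - [:poly A z:]"
  have "?p \<noteq> 0"
    using assms by (rule minus_const_nonzero)
  then obtain q where q: "?p = [:-z, 1:] ^ order z ?p * q" "\<not> [:-z, 1:] dvd q"
    using order_decomp by blast
  have "poly A (z + x) - poly A z = poly q (z + x) * x ^ order z ?p" for x
  proof -
    have "poly A (z + x) - poly A z = poly ?p (z + x)"
      by simp
    also have "\<dots> = poly q (z + x) * x ^ order z ?p"
      by (subst q(1)) (simp add: poly_power)
    finally show ?thesis .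
  qed
  then have "zorder (\<lambda>x. poly A (z + x) - poly A z) 0 = int (order z ?p)"
    using q(2) by (intro zorder_eqI[of UNIV _ "\<lambda>x. poly q (z + x)"])
      (auto intro!: holomorphic_intros simp: poly_eq_0_iff_dvd)
  then show ?thesis
    by (simp add: local_degree_def)
qed

definition affine_conjugate :: "complex \<Rightarrow> complex \<Rightarrow> complex poly \<Rightarrow> complex poly" where
  "affine_conjugate u v A = [:v, u:] \<circ>\<^sub>p A \<circ>\<^sub>p [:-v / u, 1 / u:]"

lemma poly_affine_conjugate:
  "u \<noteq> 0 \<Longrightarrow> poly (affine_conjugate u v A) (u * z + v) = u * poly A z + v"
  by (simp add: affine_conjugate_def poly_pcompose field_simps)

lemma degree_affine_conjugate: "u \<noteq> 0 \<Longrightarrow> degree (affine_conjugate u v A) = degree A"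
  by (simp add: affine_conjugate_def degree_pcompose)

lemma mobius_conjugate_affine:
  assumes "u \<noteq> 0" "degree A \<ge> 1"
  shows "mobius_conjugate (poly_map A) (poly_map (affine_conjugate u v A))"
proof -
  let ?\<mu> = "rat_map [:v, u:] [:1, 0:]"
  have "mobius ?\<mu>"
    unfolding mobius_def using assms by (intro exI[of _ u] exI[of _ v] exI[of _ 0] exI[of _ 1]) auto
  moreover have "poly_map (affine_conjugate u v A) = ?\<mu> \<circ> poly_map A \<circ> inv ?\<mu>"
  proof -
    have inj: "inj ?\<mu>"
    proof (rule injI)
      fix x y assume "?\<mu> x = ?\<mu> y"
      then show "x = y"
        using assms by (cases x; cases y) auto
    qed
    have surj: "surj ?\<mu>"
    proof (rule surjI)
      show "?\<mu> (case y of None \<Rightarrow> None | Some w \<Rightarrow> Some ((w - v) / u)) = y" for y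
        using assms by (cases y) auto
    qed
    have "poly_map (affine_conjugate u v A) (?\<mu> x) = ?\<mu> (poly_map A x)" for x
      using assms poly_affine_conjugate[of u v A] degree_affine_conjugate[of u v A]
      by (cases x) (auto simp: mult.commute add.commute)
    then show ?thesis
      using inj surj by (metis (no_types, lifting) comp_apply ext surj_f_inv_f)
  qed
  ultimately show ?thesis
    unfolding mobius_conjugate_def by blast
qed

section \<open>The differential equation of the Chebyshev polynomials\<close>

text \<open>
  The substitution \<open>z = cos t\<close> uniformizes the equation: it says that \<open>f t = B (cos t)\<close> satisfies
  \<open>f'\<^sup>2 = d\<^sup>2 (1 - f\<^sup>2)\<close>. Differentiating in \<open>z\<close> produces a factor \<open>B'\<close>, and cancelling it leaves the
  linear equation \<open>f'' = - d\<^sup>2 f\<close>. Here \<open>f' 0 = 0\<close> because of the factor \<open>sin t\<close> of \<open>f' t\<close>, so no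
  multiple of \<open>sin (d t)\<close> enters the solution. The original equation is used once more, at the
  singular point \<open>z = 1\<close>, where it forces \<open>B 1 = \<plusminus>1\<close>.
\<close>

lemma chebyshev_ode:
  fixes B :: "complex poly"
  assumes "degree B \<ge> 1"
    and ode: "\<And>z. (z\<^sup>2 - 1) * (poly (pderiv B) z)\<^sup>2 = (of_nat (degree B))\<^sup>2 * ((poly B z)\<^sup>2 - 1)"
  shows "B = chebyshev (degree B) \<or> B = - chebyshev (degree B)"
proof -
  define d :: complex where "d = of_nat (degree B)"
  have d: "d \<noteq> 0"
    using assms(1) by (simp add: d_def)
  let ?B' = "pderiv B" and ?B'' = "pderiv (pderiv B)"
  have "[:-1, 0, 1:] * (?B' * ?B') = smult (d\<^sup>2) (B * B - 1)"
    using ode by (intro poly_ext) (simp add: d_def power2_eq_square algebra_simps)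
  then have "pderiv ([:-1, 0, 1:] * (?B' * ?B')) = pderiv (smult (d\<^sup>2) (B * B - 1))"
    by (rule arg_cong)
  then have "poly (pderiv ([:-1, 0, 1:] * (?B' * ?B'))) z = poly (pderiv (smult (d\<^sup>2) (B * B - 1))) z" for z
    by (rule arg_cong)
  then have "2 * poly (?B' * ([:0, 1:] * ?B' + [:-1, 0, 1:] * ?B'' - smult (d\<^sup>2) B)) z = 0" for z
    by (simp add: pderiv_mult pderiv_smult pderiv_diff pderiv_pCons algebra_simps)
  then have "?B' * ([:0, 1:] * ?B' + [:-1, 0, 1:] * ?B'' - smult (d\<^sup>2) B) = 0"
    by (intro poly_ext) simp
  moreover have "?B' \<noteq> 0"
    using assms(1) by (simp add: pderiv_eq_0_iff)
  ultimately have "[:0, 1:] * ?B' + [:-1, 0, 1:] * ?B'' - smult (d\<^sup>2) B = 0"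
    by simp
  then have "poly ([:0, 1:] * ?B' + [:-1, 0, 1:] * ?B'' - smult (d\<^sup>2) B) z = 0" for z
    by simp
  then have lin: "z * poly ?B' z + (z\<^sup>2 - 1) * poly ?B'' z = d\<^sup>2 * poly B z" for z
    by (simp add: algebra_simps power2_eq_square)
  \<comment> \<open>Since \<open>f' = - S\<close> and \<open>S' = d\<^sup>2 f\<close>, rotating the vector
    \<open>(f, S / d)\<close> by the angle \<open>- d t\<close> gives a constant vector, with coordinates \<open>g\<close> and \<open>- h\<close>.\<close>
  define f where "f t = poly B (cos t)" for t
  define S where "S t = sin t * poly ?B' (cos t)" for t
  define g where "g t = f t * cos (d * t) + S t * sin (d * t) / d" for t
  define h where "h t = f t * sin (d * t) - S t * cos (d * t) / d" for t
  have f': "(f has_field_derivative - S t) (at t)" for t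
    unfolding f_def S_def by (auto intro!: derivative_eq_intros)
  have S': "(S has_field_derivative d\<^sup>2 * f t) (at t)" for t
  proof -
    have "(S has_field_derivative cos t * poly ?B' (cos t) + ((cos t)\<^sup>2 - 1) * poly ?B'' (cos t)) (at t)"
      unfolding S_def
      by (auto intro!: derivative_eq_intros simp: cos_squared_eq power2_eq_square[of "sin t"])
    then show ?thesis
      by (simp only: lin f_def)
  qed
  have "(g has_field_derivative 0) (at t)" for t
    unfolding g_def using d
    by (auto intro!: derivative_eq_intros f' S' simp: field_simps power2_eq_square)
  then have g: "g t = g 0" for t
    using has_field_derivative_zero_constant[of UNIV g] by (metis UNIV_I convex_UNIV)
  have "(h has_field_derivative 0) (at t)" for t
    unfolding h_def using d
    by (auto intro!: derivative_eq_intros f' S' simp: field_simps power2_eq_square)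
  then have h: "h t = h 0" for t
    using has_field_derivative_zero_constant[of UNIV h] by (metis UNIV_I convex_UNIV)
  have cos: "poly B (cos t) = poly B 1 * cos (d * t)" for t
  proof -
    have "poly B (cos t) = f t * ((sin (d * t))\<^sup>2 + (cos (d * t))\<^sup>2)"
      by (simp add: f_def)
    also have "\<dots> = g t * cos (d * t) + h t * sin (d * t)"
      unfolding g_def h_def by (simp add: algebra_simps power2_eq_square
          del: sin_cos_squared_add sin_cos_squared_add2 sin_cos_squared_add3)
    also have "\<dots> = poly B 1 * cos (d * t)"
      unfolding g[of t] h[of t] by (simp add: g_def h_def f_def S_def)
    finally show ?thesis .
  qed
  have "(poly B 1)\<^sup>2 = 1"
    using ode[of 1] d by (simp add: d_def)
  then consider "poly B 1 = 1" | "poly B 1 = - 1"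
    by (auto simp: power2_eq_1_iff)
  then show ?thesis
  proof cases
    case 1
    then show ?thesis
      using cos by (intro disjI1 chebyshev_unique) (simp add: poly_chebyshev_cos d_def)
  next
    case 2
    then show ?thesis
      using cos by (intro disjI2 chebyshev_unique) (simp add: poly_chebyshev_cos d_def)
  qed
qed

section \<open>One or two ramified finite points\<close>

text \<open>
  Splitting off the factor \<open>(x - a)^r\<close> of \<open>A - a\<close> leaves a polynomial with all root multiplicities
  divisible by \<open>n\<close>, which has an \<open>n\<close>-th root. The translation \<open>z \<mapsto> z - a\<close> then moves the fixed
  point to the origin.
\<close>

lemma conjugate_to_power_form:
  fixes A :: "complex poly"
  assumes "degree A \<ge> 1" "n \<ge> 1" "poly A a = a"
    and r: "coprime (order a (A - [:a:])) n"
    and dvd: "\<And>z. poly A z = a \<Longrightarrow> z \<noteq> a \<Longrightarrow> n dvd order z (A - [:a:])"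
  shows "\<exists>r R. r \<ge> 1 \<and> coprime r n \<and>
    mobius_conjugate (poly_map A) (poly_map (monom 1 r * R ^ n))"
proof -
  let ?p = "A - [:a:]"
  define r where "r = order a ?p"
  have p: "?p \<noteq> 0"
    using assms(1) by (rule minus_const_nonzero)
  then obtain q where q: "?p = [:-a, 1:] ^ r * q" "\<not> [:-a, 1:] dvd q"
    using order_decomp unfolding r_def by blast
  have nz: "[:-a, 1:] ^ r * q \<noteq> 0"
    using p q(1) by metis
  have "n dvd order z q" for z
  proof (cases "poly q z = 0")
    case True
    then have z: "z \<noteq> a"
      using q(2) by (auto simp: poly_eq_0_iff_dvd)
    have "order z ?p = order z ([:-a, 1:] ^ r) + order z q"
      by (subst q(1)) (rule order_mult[OF nz])
    moreover have "order z ([:-a, 1:] ^ r) = 0"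
      using z by (intro order_0I) (simp add: poly_power)
    moreover have "poly ?p z = 0"
      by (subst q(1)) (simp add: True)
    ultimately show ?thesis
      using dvd[of z] z by simp
  qed (simp add: order_0I)
  moreover have "q \<noteq> 0"
    using nz by auto
  ultimately obtain Q where Q: "q = Q ^ n"
    using complex_poly_nth_rootE \<open>n \<ge> 1\<close> by metis
  have "affine_conjugate 1 (- a) A = ?p \<circ>\<^sub>p [:a, 1:]"
    by (rule poly_ext) (simp add: affine_conjugate_def poly_pcompose)
  also have "\<dots> = monom 1 r * (Q \<circ>\<^sub>p [:a, 1:]) ^ n"
    by (subst q(1), rule poly_ext) (simp add: Q poly_pcompose poly_power poly_monom)
  finally have "mobius_conjugate (poly_map A) (poly_map (monom 1 r * (Q \<circ>\<^sub>p [:a, 1:]) ^ n))"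
    using mobius_conjugate_affine[of 1 A "- a"] assms(1) by simp
  moreover have "r \<ge> 1"
    using p assms(3) order_root[of ?p a] by (simp add: r_def)
  ultimately show ?thesis
    using r unfolding r_def by blast
qed

text \<open>
  Both sides of the divisibility have degree \<open>2 d\<close>, so the cofactor is a constant, and the leading
  coefficients identify it as \<open>d\<^sup>2\<close>. The resulting equation between \<open>A\<close> and \<open>A'\<close> is invariant under
  affine conjugation, and \<open>a = 1\<close>, \<open>b = -1\<close> is the case solved by the Chebyshev polynomials.
\<close>

lemma conjugate_to_chebyshev:
  fixes A :: "complex poly"
  assumes "degree A \<ge> 1" "a \<noteq> b"
    and dvd: "(\<Prod>c\<in>{a, b}. A - [:c:]) dvd (\<Prod>c\<in>{a, b}. [:-c, 1:]) * pderiv A ^ 2"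
  shows "mobius_conjugate (poly_map A) (poly_map (chebyshev (degree A))) \<or>
    mobius_conjugate (poly_map A) (poly_map (- chebyshev (degree A)))"
proof -
  let ?d = "of_nat (degree A) :: complex"
  let ?P = "(A - [:a:]) * (A - [:b:])" and ?G = "[:-a, 1:] * [:-b, 1:] * pderiv A ^ 2"
  have A': "pderiv A \<noteq> 0"
    using assms(1) by (simp add: pderiv_eq_0_iff)
  have deg: "degree (A - [:c:]) = degree A" "lead_coeff (A - [:c:]) = lead_coeff A" for c
    using assms(1) by (rule degree_minus_const, rule lead_coeff_minus_const)
  have "?P dvd ?G"
  proof -
    have "(\<Prod>c\<in>{a, b}. A - [:c:]) = ?P"
      using \<open>a \<noteq> b\<close> by simp
    moreover have "(\<Prod>c\<in>{a, b}. [:-c, 1:]) = [:-a, 1:] * [:-b, 1:]"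
      using \<open>a \<noteq> b\<close> by simp
    ultimately show ?thesis
      using dvd by metis
  qed
  then obtain C where C: "?G = ?P * C"
    by (elim dvdE)
  have "?G \<noteq> 0"
    using A' by (simp del: mult_pCons_left)
  then have nz: "?P \<noteq> 0" "C \<noteq> 0"
    using C by auto
  have "degree ?G = 2 * degree A"
    using A' assms(1) by (simp add: degree_mult_eq degree_power_eq degree_pderiv del: mult_pCons_left)
  moreover have "degree (?P * C) = 2 * degree A + degree C"
    using nz by (simp add: degree_mult_eq deg)
  ultimately have "degree C = 0"
    using C by simp
  then obtain c where c: "C = [:c:]"
    by (auto elim: degree_eq_zeroE)
  have "lead_coeff (pderiv A) = ?d * lead_coeff A"
    using assms(1) by (simp add: degree_pderiv coeff_pderiv of_nat_diff)
  then have "lead_coeff ?G = (?d * lead_coeff A)\<^sup>2"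
    by (simp only: lead_coeff_mult lead_coeff_power) simp
  moreover have "lead_coeff (?P * C) = lead_coeff A * lead_coeff A * c"
    by (simp only: lead_coeff_mult deg(2) c) simp
  ultimately have "(?d * lead_coeff A)\<^sup>2 = lead_coeff A * lead_coeff A * c"
    using C by metis
  then have "c = ?d\<^sup>2"
    using assms(1) by (auto simp: power2_eq_square)
  then have eq: "(z - a) * (z - b) * (poly (pderiv A) z)\<^sup>2 = ?d\<^sup>2 * ((poly A z - a) * (poly A z - b))" for z
    using arg_cong[OF C, of "\<lambda>p. poly p z"] unfolding c by (simp add: algebra_simps)
  \<comment> \<open>The affine map \<open>z \<mapsto> u z + v\<close> takes \<open>a\<close> to \<open>1\<close> and \<open>b\<close> to \<open>-1\<close>.\<close>
  define u where "u = 2 / (a - b)"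
  define v where "v = 1 - u * a"
  define B where "B = affine_conjugate u v A"
  have u: "u \<noteq> 0" and "u * (a - b) = 2"
    using \<open>a \<noteq> b\<close> by (auto simp: u_def simp del: right_diff_distrib_numeral)
  then have v: "v = - 1 - u * b"
    by (simp add: v_def algebra_simps)
  have uv: "u * z + v - 1 = u * (z - a)" "u * z + v + 1 = u * (z - b)" for z
    by (simp add: v_def algebra_simps) (simp add: v algebra_simps)
  have B: "poly B (u * z + v) = u * poly A z + v" for z
    unfolding B_def using u by (rule poly_affine_conjugate)
  have degB: "degree B = degree A"
    unfolding B_def using u by (rule degree_affine_conjugate)
  have "B \<circ>\<^sub>p [:v, u:] = [:v, u:] \<circ>\<^sub>p A"
    using B by (intro poly_ext) (simp add: poly_pcompose algebra_simps)
  then have *: "pderiv (B \<circ>\<^sub>p [:v, u:]) = pderiv ([:v, u:] \<circ>\<^sub>p A)"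
    by (rule arg_cong)
  have B': "poly (pderiv B) (u * z + v) = poly (pderiv A) z" for z
  proof -
    have "poly (pderiv (B \<circ>\<^sub>p [:v, u:])) z = poly (pderiv ([:v, u:] \<circ>\<^sub>p A)) z"
      by (simp only: *)
    then show ?thesis
      using u by (simp add: pderiv_pcompose poly_pcompose pderiv_pCons algebra_simps)
  qed
  have "(w\<^sup>2 - 1) * (poly (pderiv B) w)\<^sup>2 = ?d\<^sup>2 * ((poly B w)\<^sup>2 - 1)" for w
  proof -
    define z where "z = (w - v) / u"
    have w: "w = u * z + v"
      using u by (simp add: z_def)
    have sq: "x\<^sup>2 - 1 = (x - 1) * (x + 1)" for x :: complex
      by (simp add: algebra_simps power2_eq_square)
    have "(w\<^sup>2 - 1) * (poly (pderiv B) w)\<^sup>2 = u\<^sup>2 * ((z - a) * (z - b) * (poly (pderiv A) z)\<^sup>2)"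
      unfolding sq w B' uv by (simp add: power2_eq_square)
    also have "\<dots> = ?d\<^sup>2 * ((poly B w)\<^sup>2 - 1)"
      unfolding sq w B uv eq by (simp add: power2_eq_square)
    finally show ?thesis .
  qed
  then have "B = chebyshev (degree A) \<or> B = - chebyshev (degree A)"
    using chebyshev_ode[of B] assms(1) by (simp add: degB)
  moreover have "mobius_conjugate (poly_map A) (poly_map B)"
    unfolding B_def using u assms(1) by (rule mobius_conjugate_affine)
  ultimately show ?thesis
    by auto
qed

theorem theorem7p2:
  fixes A :: "complex poly" and \<nu> :: "rsphere \<Rightarrow> nat"
  assumes "degree A \<ge> 2"
    and "orbifold \<nu>"
    and "\<nu> \<noteq> (\<lambda>_. 1)"
    and "minimal_holomorphic_map (poly_map A) \<nu>"
  shows "(\<exists>(r::nat) (n::nat) (R :: complex poly).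
            n \<ge> 2 \<and> r \<ge> 1 \<and> coprime r n \<and>
            mobius_conjugate (poly_map A) (poly_map (monom 1 r * R ^ n))) \<or>
         (\<exists>n::nat. n \<ge> 1 \<and> coprime (degree A) n \<and>
            (mobius_conjugate (poly_map A) (poly_map (chebyshev (degree A))) \<or>
             mobius_conjugate (poly_map A) (poly_map (- chebyshev (degree A)))))"
proof -
  define F where "F = {z. \<nu> (Some z) \<noteq> 1}"
  have pos: "\<nu> z \<ge> 1" for z
    using assms(2) by (simp add: orbifold_def)
  have min: "\<nu> (Some (poly A z)) =
      \<nu> (Some z) * gcd (order z (A - [:poly A z:])) (\<nu> (Some (poly A z)))" for z
    using assms(1,4) local_degree_poly_map[of A z]
    by (auto simp: minimal_holomorphic_map_def dest!: spec[of _ "Some z"])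
  have dvd: "\<nu> (Some (poly A z)) dvd order z (A - [:poly A z:])" if "z \<notin> F" for z
  proof -
    have "\<nu> (Some z) = 1"
      using that by (simp add: F_def)
    then show ?thesis
      using min[of z] by (metis gcd_dvd1 mult_1)
  qed
  have "finite F"
  proof (rule finite_imageD)
    show "finite (Some ` F)"
      using assms(2) by (rule_tac finite_subset[of _ "{z. \<nu> z \<noteq> 1}"]) (auto simp: F_def orbifold_def)
  qed simp
  have "F \<noteq> {}"
  proof
    assume "F = {}"
    \<comment> \<open>Then infinity would be the only ramified point.\<close>
    then have fin: "\<nu> (Some z) = 1" for z
      by (auto simp: F_def)
    have "\<nu> None \<noteq> 1"
    proof
      assume "\<nu> None = 1"
      then have "\<nu> z = 1" for z
        using fin by (cases z) auto
      then show False
        using assms(3) by auto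
    qed
    then have "{z. \<nu> z \<noteq> 1} = {None}"
      using fin by (auto, metis option.exhaust)
    then show False
      using assms(2) by (auto simp: orbifold_def)
  qed
  have crit: "order z (A - [:poly A z:]) \<ge> 2" if "poly A z \<in> F" "z \<notin> F" for z
  proof -
    have "A - [:poly A z:] \<noteq> 0"
      using assms(1) by (intro minus_const_nonzero) simp
    then have "order z (A - [:poly A z:]) > 0"
      using order_root[of "A - [:poly A z:]" z] by simp
    moreover have "\<nu> (Some (poly A z)) \<ge> 2"
      using that(1) pos[of "Some (poly A z)"] by (simp add: F_def)
    ultimately show ?thesis
      using dvd[OF that(2)] dvd_imp_le order_trans by blast
  qed
  have fib: "(\<Prod>b\<in>F. A - [:b:]) dvd (\<Prod>b\<in>F. [:-b, 1:]) * pderiv A ^ 2"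
    using \<open>finite F\<close> assms(1) crit by (intro fibre_product_dvd) auto
  have "pderiv A \<noteq> 0"
    using assms(1) by (simp add: pderiv_eq_0_iff)
  then have "degree (\<Prod>b\<in>F. A - [:b:]) \<le> degree ((\<Prod>b\<in>F. [:-b, 1:]) * pderiv A ^ 2)"
    using \<open>finite F\<close> by (intro dvd_imp_degree_le[OF fib]) simp
  moreover have "degree (\<Prod>b\<in>F. A - [:b:]) = card F * degree A"
    using assms(1) minus_const_nonzero[of A] degree_minus_const[of A]
    by (simp add: degree_prod_eq_sum_degree)
  moreover have "degree ((\<Prod>b\<in>F. [:-b, 1:]) * pderiv A ^ 2) = card F + 2 * (degree A - 1)"
    using \<open>pderiv A \<noteq> 0\<close> \<open>finite F\<close>
    by (simp add: degree_mult_eq degree_power_eq degree_pderiv degree_prod_eq_sum_degree)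
  ultimately have "card F * (degree A - 1) \<le> 2 * (degree A - 1)"
    by (simp add: diff_mult_distrib2)
  then have "card F \<le> 2"
    using assms(1) by simp
  then consider "card F = 1" | "card F = 2"
    using \<open>F \<noteq> {}\<close> \<open>finite F\<close> by (metis One_nat_def card_0_eq le_SucE le_zero_eq numeral_2_eq_2)
  then show ?thesis
  proof cases
    case 1
    then obtain a where F: "F = {a}"
      by (auto simp: card_1_singleton_iff)
    let ?n = "\<nu> (Some a)"
    have n: "?n \<ge> 2"
      using F pos[of "Some a"] by (auto simp: F_def)
    have "\<nu> (Some (poly A a)) \<noteq> 1"
      using min[of a] n by auto
    then have fixed: "poly A a = a"
      using F by (auto simp: F_def)
    have "coprime (order a (A - [:a:])) ?n"
      using mult_eq_self_implies_10[OF min[of a, unfolded fixed]] n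
      by (auto simp: coprime_iff_gcd_eq_1)
    moreover have "?n dvd order z (A - [:a:])" if "poly A z = a" "z \<noteq> a" for z
      using dvd[of z] that F by simp
    ultimately have "\<exists>r R. r \<ge> 1 \<and> coprime r ?n \<and>
        mobius_conjugate (poly_map A) (poly_map (monom 1 r * R ^ ?n))"
      using fixed n assms(1) by (intro conjugate_to_power_form) auto
    then show ?thesis
      using n by blast
  next
    case 2
    then obtain a b where "F = {a, b}" "a \<noteq> b"
      by (auto simp: card_2_iff)
    then show ?thesis
      using conjugate_to_chebyshev[of A a b] fib assms(1) by (intro disjI2 exI[of _ 1]) simp
  qed
qed

end
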